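(* Let $f:\mathbb{R}^n\to\mathbb{R}$ be differentiable and let $A$ be a real $m\times n$ matrix such that for all $x,h\in\mathbb{R}^n$, $$f(x+h)\le f(x)+\langle\nabla f(x),h\rangle+\tfrac12 h^\top A^\top A h .$$ Let $\hat S$ be an arbitrary sampling of $[n]$. Then $(f,\hat S)\sim ESO(v)$ for $v=(v_1,\dots,v_n)$ defined by $$v_i=\min\{\lambda'(P(\hat S)),\lambda'(A^\top A)\}\sum_{j=1}^m A_{ji}^2,\qquad i\in[n].$$
   Context: Let $[n]=\{1,\dots,n\}$. A sampling $\hat S$ is a random subset of $[n]$; $p_i=\mathbf{P}(i\in\hat S)$. Its probability matrix $P(\hat S)$ is the $n\times n$ positive semidefinite matrix with entries $P(\hat S)_{ij}=\mathbf{P}(\{i,j\}\subseteq\hat S)$. For an $n\times n$ positive semidefinite matrix $M$, $\lambda'(M)=\max_{h\in\mathbb{R}^n}\{h^\top M h: h^\top\mathrm{Diag}(M)h\le1\}$, where $\mathrm{Diag}(M)$ is the diagonal matrix containing the diagonal of $M$. For a differentiable $f:\mathbb{R}^n\to\mathbb{R}$ and a sampling $\hat S$, one says that $f$ admits an expected separable overapproximation (ESO) with respect to $\hat S$ with parameters $v=(v_1,\dots,v_n)>0$ (all entries positive), written $(f,\hat S)\sim ESO(v)$, if for all $x,h\in\mathbb{R}^n$, $$\mathbf{E}\Big[f\Big(x+\sum_{i\in\hat S}h_ie_i\Big)\Big]\le f(x)+\sum_{i=1}^n p_i\,\nabla_i f(x)\,h_i+\frac12\sum_{i=1}^n p_iv_ih_i^2,$$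 where $e_i$ is the $i$-th standard basis vector and $\nabla_i f$ the $i$-th partial derivative.
   Formalization: The ESO inequality is proved for all A and all samplings; positivity v>0, part of ESO(v), is asserted only when A has no zero column and some p_i>0, since otherwise some v_i=0 and the claim fails. *)

theory Defs
  imports "HOL-Analysis.Analysis" "HOL-Probability.Probability"
begin

text \<open>The index set of the coordinates is the finite type \<open>'n\<close>, so that vectors have type
  \<open>real ^ 'n\<close>. A sampling (a random subset of the index set) is given by its distribution,
  an arbitrary probability mass function on \<open>'n set\<close>.\<close>

definition marginal :: "'n::finite set pmf \<Rightarrow> 'n \<Rightarrow> real" where
  "marginal S i = measure_pmf.prob S {T. i \<in> T}"

definition prob_matrix :: "'n::finite set pmf \<Rightarrow> real ^ 'n ^ 'n" where
  "prob_matrix S = (\<chi> i j. measure_pmf.prob S {T. {i, j} \<subseteq> T})"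

definition diag_part :: "real ^ 'n ^ 'n \<Rightarrow> real ^ 'n ^ 'n" where
  "diag_part M = (\<chi> i j. if i = j then M $ i $ j else 0)"

text \<open>The maximum is attained for every positive semidefinite \<open>M\<close>, even when \<open>M\<close> has zero
  diagonal entries and the feasible set is unbounded: the corresponding rows and columns of
  \<open>M\<close> then vanish. For other matrices the value may be unspecified.\<close>

definition lambda' :: "real ^ 'n ^ 'n \<Rightarrow> real" where
  "lambda' M =
    (GREATEST y. \<exists>h :: real ^ 'n. h \<bullet> (diag_part M *v h) \<le> 1 \<and> y = h \<bullet> (M *v h))"

definition partial_deriv :: "(real ^ 'n \<Rightarrow> real) \<Rightarrow> 'n::finite \<Rightarrow> real ^ 'n \<Rightarrow> real" where
  "partial_deriv f i x = deriv (\<lambda>t. f (x + t *\<^sub>R axis i 1)) 0"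

definition gradient :: "(real ^ 'n \<Rightarrow> real) \<Rightarrow> real ^ 'n \<Rightarrow> real ^ 'n::finite" where
  "gradient f x = (\<chi> i. partial_deriv f i x)"

text \<open>The inequality of an expected separable overapproximation (ESO) makes sense for any
  parameter vector; an ESO in the strict sense has positive parameters in addition.\<close>

definition ESO_inequality ::
  "(real ^ 'n \<Rightarrow> real) \<Rightarrow> 'n::finite set pmf \<Rightarrow> real ^ 'n \<Rightarrow> bool" where
  "ESO_inequality f S v \<longleftrightarrow> (\<forall>x h.
     measure_pmf.expectation S (\<lambda>T. f (x + (\<Sum>i\<in>T. h $ i *\<^sub>R axis i 1)))
       \<le> f x + (\<Sum>i\<in>UNIV. marginal S i * gradient f x $ i * h $ i)
           + 1 / 2 * (\<Sum>i\<in>UNIV. marginal S i * v $ i * (h $ i)\<^sup>2))"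

definition ESO ::
  "(real ^ 'n \<Rightarrow> real) \<Rightarrow> 'n::finite set pmf \<Rightarrow> real ^ 'n \<Rightarrow> bool" where
  "ESO f S v \<longleftrightarrow> (\<forall>i. 0 < v $ i) \<and> ESO_inequality f S v"

end

theory Submission
  imports Defs
begin

text \<open>
  Write \<open>h\<^sub>T\<close> for the vector that agrees with \<open>h\<close> on \<open>T\<close> and vanishes elsewhere, and let
  \<open>M = A\<^sup>T A\<close>. Applying the quadratic upper bound on \<open>f\<close> to \<open>h\<^sub>T\<close> and averaging over the
  sampling turns the linear term into the weighted sum of partial derivatives, because
  coordinate \<open>i\<close> survives with probability \<open>p\<^sub>i\<close>. What remains is to bound the expectation of
  \<open>h\<^sub>T\<^sup>T M h\<^sub>T\<close> by \<open>\<lambda> (\<Sum>i. p\<^sub>i M\<^sub>i\<^sub>i h\<^sub>i\<^sup>2)\<close>, where \<open>\<lambda>\<close> is either of the two numbers whose minimum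
  is taken.

  The tool for both bounds is the inequality \<open>h\<^sup>T M h \<le> \<lambda>'(M) h\<^sup>T Diag(M) h\<close> for positive
  semidefinite \<open>M\<close> (lemma \<open>quadratic_form_le_lambda'\<close>), which is the homogeneous form of the
  definition of \<open>\<lambda>'\<close>. It rests on the maximum in that definition being attained
  (lemma \<open>quadratic_form_maximum_attained\<close>), since \<open>GREATEST\<close> has no useful value otherwise.

  For \<open>\<lambda>'(M)\<close>, the tool is applied to \<open>M\<close> and every realisation \<open>h\<^sub>T\<close> separately, and the
  results are averaged (lemma \<open>expectation_quadratic_le_lambda'_gram\<close>). For \<open>\<lambda>'(P)\<close>, the
  order of summation is exchanged: the expectation of \<open>\<parallel>A h\<^sub>T\<parallel>\<^sup>2\<close> is a sum over the rows \<open>a\<close>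
  of \<open>A\<close> of the expected squares of \<open>\<Sum>i\<in>T. a\<^sub>i h\<^sub>i\<close>, each of which is the quadratic form of the
  probability matrix at the vector \<open>(a\<^sub>i h\<^sub>i)\<^sub>i\<close>; the tool is applied to the probability matrix
  and every row (lemma \<open>expectation_quadratic_le_lambda'_prob\<close>).

  Positivity of the parameters holds because \<open>\<lambda>'(M) \<ge> 1\<close> as soon as some diagonal entry of
  \<open>M\<close> is positive.
\<close>

section \<open>Positive semidefinite matrices and \<open>\<lambda>'\<close>\<close>

definition positive_semidefinite :: "real ^ 'n ^ 'n \<Rightarrow> bool" where
  "positive_semidefinite M \<longleftrightarrow> transpose M = M \<and> (\<forall>h. 0 \<le> h \<bullet> (M *v h))"

lemma quadratic_form_sum:
  fixes M :: "real ^ 'n ^ 'n"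
  shows "h \<bullet> (M *v h) = (\<Sum>i\<in>UNIV. \<Sum>j\<in>UNIV. h $ i * M $ i $ j * h $ j)"
  by (simp add: inner_vec_def matrix_vector_mult_def sum_distrib_left mult.assoc)

lemma diag_quadratic_form_sum:
  fixes M :: "real ^ 'n ^ 'n"
  shows "h \<bullet> (diag_part M *v h) = (\<Sum>i\<in>UNIV. M $ i $ i * (h $ i)\<^sup>2)"
  unfolding quadratic_form_sum
  by (simp add: diag_part_def if_distrib if_distribR sum.delta' power2_eq_square ac_simps
      cong: if_cong)

lemma axis_matrix_axis:
  fixes M :: "real ^ 'n ^ 'n"
  shows "axis i 1 \<bullet> (M *v axis j 1) = M $ i $ j"
  by (simp add: inner_axis' matrix_vector_mul_component inner_axis)

lemma positive_semidefinite_diag_nonneg: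
  fixes M :: "real ^ 'n ^ 'n"
  assumes "positive_semidefinite M"
  shows "0 \<le> M $ i $ i"
  using assms axis_matrix_axis[of i M i] unfolding positive_semidefinite_def by metis

text \<open>If \<open>M\<^sub>i\<^sub>i = 0\<close>, the form at \<open>e\<^sub>j + t e\<^sub>i\<close> is the affine function \<open>M\<^sub>j\<^sub>j + 2 t M\<^sub>i\<^sub>j\<close> of \<open>t\<close>,
  which is bounded below only if its slope vanishes.\<close>

lemma positive_semidefinite_zero_diag:
  fixes M :: "real ^ 'n ^ 'n"
  assumes psd: "positive_semidefinite M" and zero: "M $ i $ i = 0"
  shows "M $ i $ j = 0" "M $ j $ i = 0"
proof -
  have sym: "M $ j $ i = M $ i $ j"
    using psd unfolding positive_semidefinite_def transpose_def by (metis vec_lambda_beta)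
  have ge: "0 \<le> M $ j $ j + 2 * t * M $ i $ j" for t
  proof -
    have "0 \<le> (axis j 1 + t *\<^sub>R axis i 1) \<bullet> (M *v (axis j 1 + t *\<^sub>R axis i 1))"
      using psd unfolding positive_semidefinite_def by blast
    also have "\<dots> = M $ j $ j + 2 * t * M $ i $ j"
      by (simp add: matrix_vector_right_distrib matrix_vector_mult_scaleR inner_add_left
          inner_add_right axis_matrix_axis zero sym)
    finally show ?thesis .
  qed
  show "M $ i $ j = 0"
  proof (rule ccontr)
    assume "M $ i $ j \<noteq> 0"
    \<comment> \<open>at this \<open>t\<close> the affine function takes the value \<open>-1\<close>\<close>
    then show False
      using ge[of "- (M $ j $ j + 1) / (2 * M $ i $ j)"] by (simp add: field_simps)
  qed
  then show "M $ j $ i = 0"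
    using sym by simp
qed

text \<open>The feasible set is unbounded in the coordinates with \<open>M\<^sub>i\<^sub>i = 0\<close>, but neither form depends
  on them. Restricting to vectors that vanish there leaves a compact set, on which the
  continuous function \<open>h\<^sup>T M h\<close> attains its maximum.\<close>

lemma quadratic_form_maximum_attained:
  fixes M :: "real ^ 'n ^ 'n"
  assumes psd: "positive_semidefinite M"
  obtains g where "g \<bullet> (diag_part M *v g) \<le> 1"
    and "\<And>h. h \<bullet> (diag_part M *v h) \<le> 1 \<Longrightarrow> h \<bullet> (M *v h) \<le> g \<bullet> (M *v g)"
proof -
  define K where "K = {h :: real ^ 'n. h \<bullet> (diag_part M *v h) \<le> 1} \<inter>
    (\<Inter>i\<in>{i. M $ i $ i = 0}. {h. h $ i = 0})"
  have cont: "continuous_on UNIV (\<lambda>h :: real ^ 'n. h \<bullet> (B *v h))" for B :: "real ^ 'n ^ 'n"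
    by (intro continuous_on_inner continuous_on_id matrix_vector_mult_linear_continuous_on)
  have "closed K"
    unfolding K_def
    by (intro closed_Int closed_INT ballI closed_Collect_le closed_Collect_eq cont
        continuous_intros)
  moreover have "bounded K"
  proof (rule boundedI)
    fix h assume h: "h \<in> K"
    have "\<bar>h $ i\<bar> \<le> 1 / sqrt (M $ i $ i)" for i
    proof (cases "M $ i $ i = 0")
      case True
      then show ?thesis using h by (simp add: K_def)
    next
      case False
      then have pos: "0 < M $ i $ i"
        using positive_semidefinite_diag_nonneg[OF psd, of i] by simp
      have "M $ i $ i * (h $ i)\<^sup>2 \<le> (\<Sum>i\<in>UNIV. M $ i $ i * (h $ i)\<^sup>2)"
        by (rule member_le_sum) (auto simp: positive_semidefinite_diag_nonneg[OF psd])
      also have "\<dots> \<le> 1"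
        using h by (simp add: K_def diag_quadratic_form_sum)
      finally have "(h $ i)\<^sup>2 \<le> 1 / M $ i $ i"
        using pos by (simp add: field_simps)
      then have "sqrt ((h $ i)\<^sup>2) \<le> sqrt (1 / M $ i $ i)"
        by (rule real_sqrt_le_mono)
      then show ?thesis
        by (simp add: real_sqrt_divide)
    qed
    then have "(\<Sum>i\<in>UNIV. \<bar>h $ i\<bar>) \<le> (\<Sum>i\<in>UNIV. 1 / sqrt (M $ i $ i))"
      by (intro sum_mono)
    then show "norm h \<le> (\<Sum>i\<in>UNIV. 1 / sqrt (M $ i $ i))"
      using norm_le_l1_cart[of h] by linarith
  qed
  ultimately have "compact K"
    by (simp add: compact_eq_bounded_closed)
  moreover have "0 \<in> K"
    by (simp add: K_def)
  ultimately obtain g where g: "g \<in> K" and max: "\<And>h. h \<in> K \<Longrightarrow> h \<bullet> (M *v h) \<le> g \<bullet> (M *v g)"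
    using continuous_attains_sup[of K "\<lambda>h. h \<bullet> (M *v h)"] cont continuous_on_subset
    by (metis empty_iff subset_UNIV)
  show thesis
  proof (rule that)
    show "g \<bullet> (diag_part M *v g) \<le> 1"
      using g by (simp add: K_def)
  next
    fix h :: "real ^ 'n"
    assume h: "h \<bullet> (diag_part M *v h) \<le> 1"
    define h' :: "real ^ 'n" where "h' = (\<chi> i. if M $ i $ i = 0 then 0 else h $ i)"
    have "h' \<bullet> (diag_part M *v h') = h \<bullet> (diag_part M *v h)"
      unfolding diag_quadratic_form_sum by (intro sum.cong) (auto simp: h'_def)
    with h have "h' \<in> K"
      by (simp add: K_def h'_def)
    moreover have "h' \<bullet> (M *v h') = h \<bullet> (M *v h)"
    proof -
      have "h' $ i * M $ i $ j * h' $ j = h $ i * M $ i $ j * h $ j" for i j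
        using positive_semidefinite_zero_diag(1)[OF psd, of i j]
          positive_semidefinite_zero_diag(2)[OF psd, of j i]
        by (cases "M $ i $ i = 0"; cases "M $ j $ j = 0") (simp_all add: h'_def)
      then show ?thesis
        unfolding quadratic_form_sum by (simp only:)
    qed
    ultimately show "h \<bullet> (M *v h) \<le> g \<bullet> (M *v g)"
      using max by metis
  qed
qed

lemma quadratic_form_le_lambda'_feasible:
  fixes M :: "real ^ 'n ^ 'n"
  assumes psd: "positive_semidefinite M" and "h \<bullet> (diag_part M *v h) \<le> 1"
  shows "h \<bullet> (M *v h) \<le> lambda' M"
proof -
  obtain g where g: "g \<bullet> (diag_part M *v g) \<le> 1"
    and max: "\<And>h. h \<bullet> (diag_part M *v h) \<le> 1 \<Longrightarrow> h \<bullet> (M *v h) \<le> g \<bullet> (M *v g)"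
    using quadratic_form_maximum_attained[OF psd] by blast
  have "lambda' M = g \<bullet> (M *v g)"
    unfolding lambda'_def using g max by (intro Greatest_equality) auto
  then show ?thesis
    using max assms(2) by simp
qed

text \<open>Both sides are homogeneous of degree two, so \<open>h\<close> can be scaled to satisfy the constraint
  with equality, unless \<open>h\<^sup>T Diag(M) h = 0\<close>. In that case every \<open>i\<close> has \<open>h\<^sub>i = 0\<close> or a vanishing
  row of \<open>M\<close>, and both sides are zero.\<close>

lemma quadratic_form_le_lambda':
  fixes M :: "real ^ 'n ^ 'n"
  assumes psd: "positive_semidefinite M"
  shows "h \<bullet> (M *v h) \<le> lambda' M * (\<Sum>i\<in>UNIV. M $ i $ i * (h $ i)\<^sup>2)"
proof -
  define d where "d = (\<Sum>i\<in>UNIV. M $ i $ i * (h $ i)\<^sup>2)"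
  have nonneg: "0 \<le> M $ i $ i * (h $ i)\<^sup>2" for i
    using positive_semidefinite_diag_nonneg[OF psd] by simp
  have "0 \<le> d"
    unfolding d_def by (intro sum_nonneg nonneg)
  show ?thesis
  proof (cases "d = 0")
    case True
    then have "M $ i $ i * (h $ i)\<^sup>2 = 0" for i
      using sum_nonneg_eq_0_iff[of UNIV "\<lambda>i. M $ i $ i * (h $ i)\<^sup>2"] nonneg
      unfolding d_def by simp
    then have "h $ i * M $ i $ j * h $ j = 0" for i j
      using positive_semidefinite_zero_diag(1)[OF psd, of i j] by (metis mult_eq_0_iff power2_eq_square)
    then have "h \<bullet> (M *v h) = 0"
      unfolding quadratic_form_sum by (simp only: sum.neutral_const)
    then show ?thesis
      using True by (simp add: d_def)
  next
    case False
    with \<open>0 \<le> d\<close> have "0 < d" by simp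
    define g where "g = (1 / sqrt d) *\<^sub>R h"
    have scale: "g \<bullet> (B *v g) = (h \<bullet> (B *v h)) / d" for B :: "real ^ 'n ^ 'n"
      using \<open>0 < d\<close> by (simp add: g_def matrix_vector_mult_scaleR)
    have "g \<bullet> (diag_part M *v g) \<le> 1"
      using scale[of "diag_part M"] \<open>0 < d\<close> by (simp add: diag_quadratic_form_sum d_def)
    from quadratic_form_le_lambda'_feasible[OF psd this]
    show ?thesis
      unfolding scale using \<open>0 < d\<close> by (simp add: d_def[symmetric] divide_le_eq)
  qed
qed

lemma lambda'_ge_1:
  fixes M :: "real ^ 'n ^ 'n"
  assumes psd: "positive_semidefinite M" and pos: "0 < M $ i $ i"
  shows "1 \<le> lambda' M"
proof -
  have "M $ i $ i \<le> lambda' M * (\<Sum>j\<in>UNIV. M $ j $ j * (axis i 1 $ j)\<^sup>2)"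
    using quadratic_form_le_lambda'[OF psd, of "axis i 1"] by (simp add: axis_matrix_axis)
  also have "(\<Sum>j\<in>UNIV. M $ j $ j * (axis i 1 $ j)\<^sup>2) = M $ i $ i"
    by (simp add: axis_def if_distrib if_distribR sum.delta cong: if_cong)
  finally show ?thesis
    using pos by simp
qed

section \<open>Gram matrices and probability matrices\<close>

lemma quadratic_form_gram:
  fixes A :: "real ^ 'n ^ 'm"
  shows "h \<bullet> ((transpose A ** A) *v h) = (\<Sum>k\<in>UNIV. (\<Sum>i\<in>UNIV. A $ k $ i * h $ i)\<^sup>2)"
proof -
  have "h \<bullet> ((transpose A ** A) *v h) = (A *v h) \<bullet> (A *v h)"
    by (simp add: matrix_vector_mul_assoc[symmetric] transpose_matrix_vector
        inner_commute[of h] dot_lmul_matrix)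
  then show ?thesis
    by (simp add: inner_vec_def matrix_vector_mult_def power2_eq_square)
qed

lemma gram_diag:
  fixes A :: "real ^ 'n ^ 'm"
  shows "(transpose A ** A) $ i $ i = (\<Sum>k\<in>UNIV. (A $ k $ i)\<^sup>2)"
  by (simp add: matrix_matrix_mult_def transpose_def power2_eq_square)

lemma positive_semidefinite_gram:
  fixes A :: "real ^ 'n ^ 'm"
  shows "positive_semidefinite (transpose A ** A)"
  unfolding positive_semidefinite_def quadratic_form_gram
  by (auto simp: matrix_transpose_mul intro: sum_nonneg)

lemma expectation_set_pmf:
  fixes S :: "'n::finite set pmf" and F :: "'n set \<Rightarrow> real"
  shows "measure_pmf.expectation S F = (\<Sum>T\<in>UNIV. pmf S T * F T)"
  by (simp add: integral_measure_pmf_real[of UNIV] mult.commute)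

lemma prob_set_pmf:
  fixes S :: "'n::finite set pmf"
  shows "measure_pmf.prob S {T. Q T} = (\<Sum>T\<in>UNIV. pmf S T * of_bool (Q T))"
  by (simp add: measure_measure_pmf_finite sum.If_cases of_bool_def if_distrib cong: if_cong)

text \<open>Indicators turn sums over the random set into sums over the fixed index type, which can be
  exchanged with the sum over all sets. The right-hand side is again a sum over a set, so
  rewriting has to be instantiated at \<open>T\<close> to terminate.\<close>

lemma sum_subset_of_bool:
  fixes g :: "'n::finite \<Rightarrow> real"
  shows "(\<Sum>i\<in>T. g i) = (\<Sum>i\<in>UNIV. of_bool (i \<in> T) * g i)"
  by simp

lemma expectation_linear:
  fixes S :: "'n::finite set pmf"
  shows "(\<Sum>T\<in>UNIV. pmf S T * (\<Sum>i\<in>T. g i)) = (\<Sum>i\<in>UNIV. marginal S i * g i)"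
proof -
  have "pmf S T * (\<Sum>i\<in>T. g i) = (\<Sum>i\<in>UNIV. pmf S T * of_bool (i \<in> T) * g i)" for T
    by (simp only: sum_subset_of_bool[of g T] sum_distrib_left mult.assoc)
  then have "(\<Sum>T\<in>UNIV. pmf S T * (\<Sum>i\<in>T. g i))
      = (\<Sum>T\<in>UNIV. \<Sum>i\<in>UNIV. pmf S T * of_bool (i \<in> T) * g i)"
    by (simp only:)
  also have "\<dots> = (\<Sum>i\<in>UNIV. \<Sum>T\<in>UNIV. pmf S T * of_bool (i \<in> T) * g i)"
    by (rule sum.swap)
  finally show ?thesis
    by (simp only: marginal_def prob_set_pmf sum_distrib_right)
qed

text \<open>Expanding the square gives the products \<open>h\<^sub>i h\<^sub>j\<close> over pairs in \<open>T\<close>, and a pair lies in the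
  random set with probability \<open>P\<^sub>i\<^sub>j\<close>. The right-hand side shows that the probability matrix
  is positive semidefinite.\<close>

lemma quadratic_form_prob_matrix:
  fixes S :: "'n::finite set pmf"
  shows "h \<bullet> (prob_matrix S *v h) = (\<Sum>T\<in>UNIV. pmf S T * (\<Sum>i\<in>T. h $ i)\<^sup>2)"
proof -
  have pairs: "pmf S T * (\<Sum>i\<in>T. h $ i)\<^sup>2
      = (\<Sum>i\<in>UNIV. \<Sum>j\<in>UNIV. h $ i * (pmf S T * of_bool ({i, j} \<subseteq> T)) * h $ j)" for T
    by (simp only: sum_subset_of_bool[of _ T] power2_eq_square sum_product sum_distrib_left
        insert_subset empty_subsetI simp_thms of_bool_conj ac_simps)
  have "(\<Sum>T\<in>UNIV. pmf S T * (\<Sum>i\<in>T. h $ i)\<^sup>2)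
      = (\<Sum>T\<in>UNIV. \<Sum>i\<in>UNIV. \<Sum>j\<in>UNIV. h $ i * (pmf S T * of_bool ({i, j} \<subseteq> T)) * h $ j)"
    by (simp only: pairs)
  also have "\<dots> = (\<Sum>i\<in>UNIV. \<Sum>j\<in>UNIV. \<Sum>T\<in>UNIV. h $ i * (pmf S T * of_bool ({i, j} \<subseteq> T)) * h $ j)"
    by (subst sum.swap, intro sum.cong refl, rule sum.swap)
  finally show ?thesis
    by (simp only: quadratic_form_sum prob_matrix_def prob_set_pmf vec_lambda_beta
        sum_distrib_right sum_distrib_left)
qed

lemma prob_matrix_diag: "prob_matrix S $ i $ i = marginal S i"
  by (simp add: prob_matrix_def marginal_def)

lemma positive_semidefinite_prob_matrix:
  fixes S :: "'n::finite set pmf"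
  shows "positive_semidefinite (prob_matrix S)"
proof -
  have "transpose (prob_matrix S) = prob_matrix S"
    by (simp add: transpose_def prob_matrix_def vec_eq_iff insert_commute conj_commute)
  then show ?thesis
    unfolding positive_semidefinite_def quadratic_form_prob_matrix
    by (auto intro!: sum_nonneg)
qed

section \<open>Expected quadratic forms of randomly restricted vectors\<close>

definition restrict_vec :: "'n set \<Rightarrow> real ^ 'n \<Rightarrow> real ^ 'n" where
  "restrict_vec T h = (\<chi> i. of_bool (i \<in> T) * h $ i)"

lemma restrict_vec_eq_sum_axis:
  fixes h :: "real ^ 'n::finite"
  shows "(\<Sum>i\<in>T. h $ i *\<^sub>R axis i 1) = restrict_vec T h"
  by (simp add: vec_eq_iff restrict_vec_def axis_def if_distrib of_bool_def cong: if_cong)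

text \<open>The bound holds for every realisation \<open>T\<close>, and the weights \<open>M\<^sub>i\<^sub>i h\<^sub>i\<^sup>2\<close> with \<open>i \<in> T\<close> average to
  \<open>p\<^sub>i M\<^sub>i\<^sub>i h\<^sub>i\<^sup>2\<close>.\<close>

lemma expectation_quadratic_le_lambda'_gram:
  fixes A :: "real ^ 'n ^ 'm" and S :: "'n set pmf"
  shows "(\<Sum>T\<in>UNIV. pmf S T * (restrict_vec T h \<bullet> ((transpose A ** A) *v restrict_vec T h)))
    \<le> lambda' (transpose A ** A)
      * (\<Sum>i\<in>UNIV. marginal S i * ((\<Sum>k\<in>UNIV. (A $ k $ i)\<^sup>2) * (h $ i)\<^sup>2))"
proof -
  let ?M = "transpose A ** A"
  have "restrict_vec T h \<bullet> (?M *v restrict_vec T h)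
      \<le> lambda' ?M * (\<Sum>i\<in>T. ?M $ i $ i * (h $ i)\<^sup>2)" for T
  proof -
    have "(\<Sum>i\<in>T. ?M $ i $ i * (h $ i)\<^sup>2) = (\<Sum>i\<in>UNIV. ?M $ i $ i * (restrict_vec T h $ i)\<^sup>2)"
      unfolding sum_subset_of_bool[of _ T] by (intro sum.cong refl) (simp add: restrict_vec_def)
    then show ?thesis
      using quadratic_form_le_lambda'[OF positive_semidefinite_gram, of "restrict_vec T h" A]
      by (simp only:)
  qed
  then have "(\<Sum>T\<in>UNIV. pmf S T * (restrict_vec T h \<bullet> (?M *v restrict_vec T h)))
      \<le> (\<Sum>T\<in>UNIV. pmf S T * (lambda' ?M * (\<Sum>i\<in>T. ?M $ i $ i * (h $ i)\<^sup>2)))"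
    by (intro sum_mono mult_left_mono) auto
  also have "\<dots> = lambda' ?M * (\<Sum>T\<in>UNIV. pmf S T * (\<Sum>i\<in>T. ?M $ i $ i * (h $ i)\<^sup>2))"
    by (simp add: sum_distrib_left mult.left_commute)
  finally show ?thesis
    by (simp add: expectation_linear gram_diag)
qed

text \<open>The \<open>k\<close>-th entry of \<open>A h\<^sub>T\<close> is the sum over \<open>T\<close> of the fixed vector \<open>a k\<close>, so its expected
  square is the quadratic form of the probability matrix at \<open>a k\<close>. Adding over \<open>k\<close> the bounds
  by \<open>\<lambda>'(P)\<close> yields the squared column norms of \<open>A\<close>.\<close>

lemma expectation_quadratic_le_lambda'_prob:
  fixes A :: "real ^ 'n ^ 'm" and S :: "'n set pmf"
  shows "(\<Sum>T\<in>UNIV. pmf S T * (restrict_vec T h \<bullet> ((transpose A ** A) *v restrict_vec T h)))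
    \<le> lambda' (prob_matrix S)
      * (\<Sum>i\<in>UNIV. marginal S i * ((\<Sum>k\<in>UNIV. (A $ k $ i)\<^sup>2) * (h $ i)\<^sup>2))"
proof -
  define a :: "'m \<Rightarrow> real ^ 'n" where "a k = (\<chi> i. A $ k $ i * h $ i)" for k
  have "restrict_vec T h \<bullet> ((transpose A ** A) *v restrict_vec T h)
      = (\<Sum>k\<in>UNIV. (\<Sum>i\<in>T. a k $ i)\<^sup>2)" for T
    unfolding quadratic_form_gram sum_subset_of_bool[of _ T]
    by (simp add: restrict_vec_def a_def mult.left_commute)
  then have "(\<Sum>T\<in>UNIV. pmf S T * (restrict_vec T h \<bullet> ((transpose A ** A) *v restrict_vec T h)))
      = (\<Sum>T\<in>UNIV. \<Sum>k\<in>UNIV. pmf S T * (\<Sum>i\<in>T. a k $ i)\<^sup>2)"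
    by (simp add: sum_distrib_left)
  also have "\<dots> = (\<Sum>k\<in>UNIV. a k \<bullet> (prob_matrix S *v a k))"
    unfolding quadratic_form_prob_matrix by (rule sum.swap)
  also have "\<dots> \<le> (\<Sum>k\<in>UNIV. lambda' (prob_matrix S)
      * (\<Sum>i\<in>UNIV. prob_matrix S $ i $ i * (a k $ i)\<^sup>2))"
    by (intro sum_mono quadratic_form_le_lambda' positive_semidefinite_prob_matrix)
  also have "\<dots> = lambda' (prob_matrix S)
      * (\<Sum>k\<in>UNIV. \<Sum>i\<in>UNIV. marginal S i * ((A $ k $ i)\<^sup>2 * (h $ i)\<^sup>2))"
    by (simp add: sum_distrib_left prob_matrix_diag a_def power_mult_distrib)
  also have "(\<Sum>k\<in>UNIV. \<Sum>i\<in>UNIV. marginal S i * ((A $ k $ i)\<^sup>2 * (h $ i)\<^sup>2))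
      = (\<Sum>i\<in>UNIV. marginal S i * ((\<Sum>k\<in>UNIV. (A $ k $ i)\<^sup>2) * (h $ i)\<^sup>2))"
    by (subst sum.swap) (simp add: sum_distrib_left sum_distrib_right)
  finally show ?thesis .
qed

section \<open>The expected separable overapproximation\<close>

text \<open>The upper bound on \<open>f\<close> at \<open>x + h\<^sub>T\<close> has a constant term, which averages to itself because
  the probabilities sum to one, a term linear in \<open>h\<^sub>T\<close>, which averages by linearity of
  expectation, and a quadratic term. So the parameters have to control only the expected
  quadratic form.\<close>

lemma ESO_inequalityI:
  fixes f :: "real ^ 'n \<Rightarrow> real" and S :: "'n set pmf"
  assumes upper: "\<And>x h. f (x + h) \<le> f x + gradient f x \<bullet> h + 1 / 2 * (h \<bullet> (M *v h))"
    and quad: "\<And>h. (\<Sum>T\<in>UNIV. pmf S T * (restrict_vec T h \<bullet> (M *v restrict_vec T h)))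
      \<le> (\<Sum>i\<in>UNIV. marginal S i * v $ i * (h $ i)\<^sup>2)"
  shows "ESO_inequality f S v"
  unfolding ESO_inequality_def
proof (intro allI)
  fix x h :: "real ^ 'n"
  let ?r = "\<lambda>T. restrict_vec T h"
  have lin: "gradient f x \<bullet> ?r T = (\<Sum>i\<in>T. gradient f x $ i * h $ i)" for T
    unfolding sum_subset_of_bool[of _ T] by (simp add: inner_vec_def restrict_vec_def mult.left_commute)
  have total: "(\<Sum>T\<in>UNIV. pmf S T) = 1"
    by (rule sum_pmf_eq_1) auto
  have "measure_pmf.expectation S (\<lambda>T. f (x + (\<Sum>i\<in>T. h $ i *\<^sub>R axis i 1)))
      = (\<Sum>T\<in>UNIV. pmf S T * f (x + ?r T))"
    by (simp add: expectation_set_pmf restrict_vec_eq_sum_axis)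
  also have "\<dots> \<le> (\<Sum>T\<in>UNIV. pmf S T * (f x + gradient f x \<bullet> ?r T + 1 / 2 * (?r T \<bullet> (M *v ?r T))))"
    by (intro sum_mono mult_left_mono upper) auto
  also have "\<dots> = (\<Sum>T\<in>UNIV. pmf S T) * f x + (\<Sum>T\<in>UNIV. pmf S T * (gradient f x \<bullet> ?r T))
      + 1 / 2 * (\<Sum>T\<in>UNIV. pmf S T * (?r T \<bullet> (M *v ?r T)))"
    by (simp add: distrib_left sum.distrib sum_distrib_right sum_distrib_left mult.left_commute)
  also have "\<dots> = f x + (\<Sum>i\<in>UNIV. marginal S i * gradient f x $ i * h $ i)
      + 1 / 2 * (\<Sum>T\<in>UNIV. pmf S T * (?r T \<bullet> (M *v ?r T)))"
    by (simp add: total lin expectation_linear mult.assoc)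
  also have "\<dots> \<le> f x + (\<Sum>i\<in>UNIV. marginal S i * gradient f x $ i * h $ i)
      + 1 / 2 * (\<Sum>i\<in>UNIV. marginal S i * v $ i * (h $ i)\<^sup>2)"
    using quad[of h] by simp
  finally show "measure_pmf.expectation S (\<lambda>T. f (x + (\<Sum>i\<in>T. h $ i *\<^sub>R axis i 1)))
      \<le> f x + (\<Sum>i\<in>UNIV. marginal S i * gradient f x $ i * h $ i)
        + 1 / 2 * (\<Sum>i\<in>UNIV. marginal S i * v $ i * (h $ i)\<^sup>2)" .
qed

theorem theorem5p1:
  fixes f :: "real ^ 'n \<Rightarrow> real"
    and A :: "real ^ 'n ^ 'm"
    and S :: "'n set pmf"
    and v :: "real ^ 'n"
  assumes "\<forall>x. f differentiable (at x)"
    and "\<forall>x h. f (x + h) \<le> f x + gradient f x \<bullet> h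
           + 1 / 2 * (h \<bullet> ((transpose A ** A) *v h))"
    and "v = (\<chi> i. min (lambda' (prob_matrix S)) (lambda' (transpose A ** A))
                     * (\<Sum>j\<in>UNIV. (A $ j $ i)\<^sup>2))"
  shows "ESO_inequality f S v \<and>
    ((\<forall>i. column i A \<noteq> 0) \<and> (\<exists>i. marginal S i > 0) \<longrightarrow> ESO f S v)"
proof -
  define l where "l = min (lambda' (prob_matrix S)) (lambda' (transpose A ** A))"
  have v: "v $ i = l * (\<Sum>k\<in>UNIV. (A $ k $ i)\<^sup>2)" for i
    by (simp add: assms(3) l_def)
  have ineq: "ESO_inequality f S v"
  proof (rule ESO_inequalityI)
    show "f (x + h) \<le> f x + gradient f x \<bullet> h + 1 / 2 * (h \<bullet> ((transpose A ** A) *v h))" for x h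
      using assms(2) by blast
  next
    fix h
    have "(\<Sum>T\<in>UNIV. pmf S T * (restrict_vec T h \<bullet> ((transpose A ** A) *v restrict_vec T h)))
        \<le> l * (\<Sum>i\<in>UNIV. marginal S i * ((\<Sum>k\<in>UNIV. (A $ k $ i)\<^sup>2) * (h $ i)\<^sup>2))"
      using expectation_quadratic_le_lambda'_gram[of S h A]
        expectation_quadratic_le_lambda'_prob[of S h A]
      unfolding l_def min_def by simp
    also have "\<dots> = (\<Sum>i\<in>UNIV. marginal S i * v $ i * (h $ i)\<^sup>2)"
      unfolding v by (subst sum_distrib_left, intro sum.cong refl) (simp only: ac_simps)
    finally show "(\<Sum>T\<in>UNIV. pmf S T * (restrict_vec T h \<bullet> ((transpose A ** A) *v restrict_vec T h)))
        \<le> (\<Sum>i\<in>UNIV. marginal S i * v $ i * (h $ i)\<^sup>2)" .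
  qed
  have "ESO f S v" if col: "\<forall>i. column i A \<noteq> 0" and marg: "\<exists>i. marginal S i > 0"
  proof -
    have norm_pos: "0 < (\<Sum>k\<in>UNIV. (A $ k $ i)\<^sup>2)" for i
    proof -
      obtain k where "A $ k $ i \<noteq> 0"
        using col by (metis column_def vec_eq_iff vec_lambda_beta zero_index)
      then show ?thesis
        by (intro sum_pos2[of UNIV k]) auto
    qed
    \<comment> \<open>all columns are nonzero, so an arbitrary index serves as the witness\<close>
    have "1 \<le> lambda' (transpose A ** A)"
      by (rule lambda'_ge_1[OF positive_semidefinite_gram, where i = undefined])
        (simp only: gram_diag norm_pos)
    moreover have "1 \<le> lambda' (prob_matrix S)"
      using marg lambda'_ge_1[OF positive_semidefinite_prob_matrix[of S]]
      by (auto simp: prob_matrix_diag)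
    ultimately have "0 < l"
      by (simp add: l_def)
    then show ?thesis
      unfolding ESO_def using ineq norm_pos v by simp
  qed
  with ineq show ?thesis by blast
qed

end
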